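(* Let $E$ be a row-finite graph, let $v$ be a cofinal vertex of $E$, and let $F$ be the reverse explosion of $E$ at an edge whose source in the reverse graph of $E$ is $v$. Let $v',v''$ be the two vertices of $F$ into which $v$ is split, with $v'$ the one attached to the chosen edge. Then the groupoid of $E$ pointed at $v$ and the groupoid of $F$ pointed at $v''$ are isomorphic as topological groupoids: $\mathcal{G}_{(E,\{v\})}\cong\mathcal{G}_{(F,\{v''\})}$.
   Context: Graphs. A directed graph $E$ consists of a vertex set $E^0$, an edge set $E^1$ and source and range maps $s,r:E^1\to E^0$. Throughout, "graph" means a countable directed graph without multiple edges (at most one edge from $v$ to $w$ for each ordered pair $(v,w)$; loops allowed) which is connected (any two vertices are joined by an undirected path). $E$ is row-finite if every vertex is the source of only finitely many edges. $E^*$ denotes the set of finite paths (including vertices as paths of length $0$), $E^\infty$ the set of infinite paths $x=x_1x_2\cdots$; $|\alpha|$ is the length of $\alpha\in E^*$. A vertex $v$ of $E$ is cofinal if for every $x\in E^\infty$ there is a finite path from $v$ to $s(x_i)$ for some $i$. The reverse graph of $E$ has the same vertices, with all edges reversed. Edge explosion. Let $G$ be a graph, $v\in G^0$ with $|s^{-1}(v)|>1$, and $e$ an edge of $G$ with source $v$; put $M_1=\{e\}$ and $M_2=s^{-1}(v)\setminus\{e\}$. The edge explosion of $G$ at $e$ has vertex set $(G^0\setminus\{v\})\cup\{v',v''\}$ and the following edges: all edges of $G$ with neither source nor range equal to $v$; for each edge of $G$ from a vertex $u\ne v$ to $v$, one edge from $u$ to $v'$ and one from $u$ to $v''$; for each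 edge in $M_1$ from $v$ to $w\neq v$, an edge from $v'$ to $w$; for each edge in $M_2$ from $v$ to $w\ne v$, an edge from $v''$ to $w$; if the loop at $v$ exists and equals $e$, a loop at $v'$ and an edge from $v'$ to $v''$; if the loop at $v$ exists and lies in $M_2$, a loop at $v''$ and an edge from $v''$ to $v'$. Reverse explosion. $F$ is a reverse explosion of $E$ at a vertex $v$ (at an edge) if the reverse graph of $F$ is the explosion of the reverse graph of $E$ at $v$ (at that edge, viewed in the reverse graph, where its source is $v$) and $v$ is cofinal in $E$. Path groupoid. For $x,y\in E^\infty$, $k\in\mathbf{Z}$, write $x\sim_k y$ if $x_i=y_{i-k}$ for all large $i$. Then $\mathcal{G}_E=\{(x,k,y):x\sim_k y\}$ with $(x,k,y)^{-1}=(y,-k,x)$ and $(x,k,y)(y,l,z)=(x,k+l,z)$, with the topology generated by the sets $Z(\alpha,\beta)=\{(\alpha x,|\alpha|-|\beta|,\beta x): x\in E^\infty,\ s(x)=r(\alpha)\}$ for $\alpha,\beta\in E^*$ with $r(\alpha)=r(\beta)$. For $S\subseteq E^0$, the groupoid of $E$ pointed at $S$ is $\mathcal{G}_{(E,S)}=\{(x,k,y)\in\mathcal{G}_E: s(x),s(y)\in S\}$, the restriction of $\mathcal{G}_E$ to $\{x\in E^\infty:s(x)\in S\}$. *)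

theory Defs
  imports
    "HOL-Analysis.Analysis"
    "HOL-Library.Omega_Words_Fun"
    "Graph_Theory.Digraph_Component"
begin

section \<open>Graphs\<close>

text \<open>Source and range of an edge are \<open>tail\<close> and \<open>head\<close>.\<close>

definition countable_graph :: "('a, 'b) pre_digraph \<Rightarrow> bool" where
  "countable_graph E \<longleftrightarrow>
     nomulti_digraph E \<and> countable (verts E) \<and> countable (arcs E) \<and>
     Digraph_Component.connected E"

definition row_finite :: "('a, 'b) pre_digraph \<Rightarrow> bool" where
  "row_finite E \<longleftrightarrow> (\<forall>v\<in>verts E. finite (out_arcs E v))"

text \<open>Infinite paths are indexed from 0.  A finite path from \<open>u\<close> to \<open>w\<close> is
  an \<open>awalk\<close>: a list of arcs together with its end points, so that
  \<open>awalk E u [] u\<close> is the vertex \<open>u\<close> viewed as a path of length 0.\<close>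

definition inf_paths :: "('a, 'b) pre_digraph \<Rightarrow> 'b word set" where
  "inf_paths E = {x. \<forall>i. x i \<in> arcs E \<and> head E (x i) = tail E (x (Suc i))}"

definition cofinal_vertex :: "('a, 'b) pre_digraph \<Rightarrow> 'a \<Rightarrow> bool" where
  "cofinal_vertex E v \<longleftrightarrow>
     v \<in> verts E \<and>
     (\<forall>x\<in>inf_paths E. \<exists>i p. pre_digraph.awalk E v p (tail E (x i)))"

definition reverse_graph :: "('a, 'b) pre_digraph \<Rightarrow> ('a, 'b) pre_digraph" where
  "reverse_graph E =
     \<lparr> verts = verts E, arcs = arcs E, tail = head E, head = tail E \<rparr>"

section \<open>Edge explosions\<close>

text \<open>\<open>Split1\<close> and \<open>Split2\<close> are the vertices \<open>v'\<close> and \<open>v''\<close>.\<close>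

datatype 'a exploded = Kept 'a | Split1 | Split2

text \<open>As graphs have no multiple edges, the edges of the explosion are given by
  their pairs of end points.\<close>

definition edge_explosion ::
    "('a, 'b) pre_digraph \<Rightarrow> 'b \<Rightarrow> ('a exploded, 'a exploded \<times> 'a exploded) pre_digraph"
where
  "edge_explosion G e =
     (let v = tail G e; M1 = {e}; M2 = out_arcs G v - {e} in
      \<lparr> verts = Kept ` (verts G - {v}) \<union> {Split1, Split2},
        arcs =
          {(Kept (tail G a), Kept (head G a)) | a.
             a \<in> arcs G \<and> tail G a \<noteq> v \<and> head G a \<noteq> v} \<union>
          {(Kept (tail G a), Split1) | a. a \<in> arcs G \<and> tail G a \<noteq> v \<and> head G a = v} \<union>
          {(Kept (tail G a), Split2) | a. a \<in> arcs G \<and> tail G a \<noteq> v \<and> head G a = v} \<union>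
          {(Split1, Kept (head G a)) | a. a \<in> M1 \<and> head G a \<noteq> v} \<union>
          {(Split2, Kept (head G a)) | a. a \<in> M2 \<and> head G a \<noteq> v} \<union>
          (if \<exists>a\<in>M1. head G a = v then {(Split1, Split1), (Split1, Split2)} else {}) \<union>
          (if \<exists>a\<in>M2. head G a = v then {(Split2, Split2), (Split2, Split1)} else {}),
        tail = fst,
        head = snd \<rparr>)"

text \<open>The first disjunct is needed because \<open>card\<close> is 0 on infinite sets and
  the vertex may emit infinitely many edges.\<close>

definition is_edge_explosion ::
    "('a, 'b) pre_digraph \<Rightarrow> 'b \<Rightarrow>
     ('a exploded, 'a exploded \<times> 'a exploded) pre_digraph \<Rightarrow> bool"
where
  "is_edge_explosion G e H \<longleftrightarrow>
     e \<in> arcs G \<and>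
     (infinite (out_arcs G (tail G e)) \<or> card (out_arcs G (tail G e)) > 1) \<and>
     H = edge_explosion G e"

definition is_reverse_explosion ::
    "('a, 'b) pre_digraph \<Rightarrow> 'b \<Rightarrow>
     ('a exploded, 'a exploded \<times> 'a exploded) pre_digraph \<Rightarrow> bool"
where
  "is_reverse_explosion E e F \<longleftrightarrow>
     is_edge_explosion (reverse_graph E) e (reverse_graph F) \<and>
     cofinal_vertex E (tail (reverse_graph E) e)"

lemma nomulti_digraph_edge_explosion:
  assumes "nomulti_digraph G" and "e \<in> arcs G"
  shows "nomulti_digraph (edge_explosion G e)"
proof -
  interpret nomulti_digraph G by (fact assms(1))
  show ?thesis
    using assms(2)
    by unfold_locales
      (auto simp: edge_explosion_def Let_def arc_to_ends_def out_arcs_def split: if_splits)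
qed

section \<open>Topological groupoids\<close>

text \<open>\<open>gmult\<close> is meaningful only on the pairs in \<open>gcomposable\<close>.\<close>

record 'g top_groupoid =
  arrows :: "'g set"
  gcomposable :: "('g \<times> 'g) set"
  gmult :: "'g \<Rightarrow> 'g \<Rightarrow> 'g"
  ginv :: "'g \<Rightarrow> 'g"
  gtop :: "'g topology"

definition top_groupoid_isomorphism ::
    "'g top_groupoid \<Rightarrow> 'h top_groupoid \<Rightarrow> ('g \<Rightarrow> 'h) \<Rightarrow> bool"
where
  "top_groupoid_isomorphism G H \<phi> \<longleftrightarrow>
     bij_betw \<phi> (arrows G) (arrows H) \<and>
     (\<forall>g\<in>arrows G. \<forall>h\<in>arrows G.
        ((g, h) \<in> gcomposable G \<longleftrightarrow> (\<phi> g, \<phi> h) \<in> gcomposable H) \<and>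
        ((g, h) \<in> gcomposable G \<longrightarrow> \<phi> (gmult G g h) = gmult H (\<phi> g) (\<phi> h))) \<and>
     (\<forall>g\<in>arrows G. \<phi> (ginv G g) = ginv H (\<phi> g)) \<and>
     homeomorphic_map (gtop G) (gtop H) \<phi>"

definition isomorphic_top_groupoids :: "'g top_groupoid \<Rightarrow> 'h top_groupoid \<Rightarrow> bool" where
  "isomorphic_top_groupoids G H \<longleftrightarrow> (\<exists>\<phi>. top_groupoid_isomorphism G H \<phi>)"

section \<open>Path groupoids\<close>

type_synonym 'b path_arrow = "'b word \<times> int \<times> 'b word"

definition shift_equiv :: "int \<Rightarrow> 'b word \<Rightarrow> 'b word \<Rightarrow> bool" where
  "shift_equiv k x y \<longleftrightarrow> (\<exists>N. \<forall>i\<ge>N. int i \<ge> k \<and> x i = y (nat (int i - k)))"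

definition path_arrows :: "('a, 'b) pre_digraph \<Rightarrow> 'b path_arrow set" where
  "path_arrows E = {(x, k, y). x \<in> inf_paths E \<and> y \<in> inf_paths E \<and> shift_equiv k x y}"

fun path_arrow_mult :: "'b path_arrow \<Rightarrow> 'b path_arrow \<Rightarrow> 'b path_arrow" where
  "path_arrow_mult (x, k, y) (y', l, z) = (x, k + l, z)"

fun path_arrow_inv :: "'b path_arrow \<Rightarrow> 'b path_arrow" where
  "path_arrow_inv (x, k, y) = (y, - k, x)"

text \<open>\<open>cylinder E \<alpha> \<beta> w\<close> is \<open>Z(\<alpha>, \<beta>)\<close> for finite paths with common range \<open>w\<close>, which
  has to be supplied because it is not determined by the empty list of arcs.\<close>

definition cylinder :: "('a, 'b) pre_digraph \<Rightarrow> 'b list \<Rightarrow> 'b list \<Rightarrow> 'a \<Rightarrow> 'b path_arrow set" where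
  "cylinder E \<alpha> \<beta> w =
     {(conc \<alpha> x, int (length \<alpha>) - int (length \<beta>), conc \<beta> x) | x.
        x \<in> inf_paths E \<and> tail E (x 0) = w}"

definition path_groupoid_topology :: "('a, 'b) pre_digraph \<Rightarrow> 'b path_arrow topology" where
  "path_groupoid_topology E =
     topology_generated_by
       {cylinder E \<alpha> \<beta> w | \<alpha> \<beta> u u' w.
          pre_digraph.awalk E u \<alpha> w \<and> pre_digraph.awalk E u' \<beta> w}"

definition pointed_path_arrows :: "('a, 'b) pre_digraph \<Rightarrow> 'a set \<Rightarrow> 'b path_arrow set" where
  "pointed_path_arrows E S =
     {(x, k, y). (x, k, y) \<in> path_arrows E \<and> tail E (x 0) \<in> S \<and> tail E (y 0) \<in> S}"

text \<open>The groupoid of \<open>E\<close> pointed at \<open>S\<close>; the full path groupoid is the case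
  \<open>S = verts E\<close>.\<close>

definition pointed_groupoid :: "('a, 'b) pre_digraph \<Rightarrow> 'a set \<Rightarrow> 'b path_arrow top_groupoid" where
  "pointed_groupoid E S =
     \<lparr> arrows = pointed_path_arrows E S,
       gcomposable = {((x, k, y), (y', l, z)) | x k y y' l z.
          (x, k, y) \<in> pointed_path_arrows E S \<and>
          (y', l, z) \<in> pointed_path_arrows E S \<and> y = y'},
       gmult = path_arrow_mult,
       ginv = path_arrow_inv,
       gtop = subtopology (path_groupoid_topology E) (pointed_path_arrows E S) \<rparr>"

lemma awalk_prefix_inf_path:
  assumes "wf_digraph E" and "x \<in> inf_paths E"
  shows "pre_digraph.awalk E (tail E (x 0)) (map x [0..<n]) (tail E (x n))"
proof (induction n)
  case 0
  interpret wf_digraph E by (fact assms(1))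
  show ?case using assms(2) by (auto simp: inf_paths_def awalk_def)
next
  case (Suc n)
  interpret wf_digraph E by (fact assms(1))
  have "awalk (tail E (x n)) [x n] (tail E (x (Suc n)))"
    using assms(2) by (auto simp: inf_paths_def awalk_def)
  with Suc show ?case using awalk_appendI by fastforce
qed

lemma conc_inf_path:
  assumes "wf_digraph E" "pre_digraph.awalk E u p (tail E (x 0))" "x \<in> inf_paths E"
  shows "conc p x \<in> inf_paths E"
  using assms(2)
proof (induction p arbitrary: u)
  case Nil
  then show ?case using assms(3) by simp
next
  case (Cons a p)
  interpret wf_digraph E by (fact assms(1))
  from Cons.prems have a: "a \<in> arcs E" and p: "awalk (head E a) p (tail E (x 0))"
    by (auto simp: awalk_Cons_iff)
  have "tail E (conc p x 0) = head E a"
    using p by (cases p) (auto simp: conc_def awalk_Cons_iff awalk_Nil_iff)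
  moreover have "conc (a # p) x = (\<lambda>i. case i of 0 \<Rightarrow> a | Suc j \<Rightarrow> conc p x j)"
    by (auto simp: conc_def fun_eq_iff split: nat.split)
  ultimately show ?case
    using Cons.IH[OF p] a by (auto simp: inf_paths_def split: nat.split)
qed

lemma topspace_path_groupoid_topology:
  assumes "wf_digraph E"
  shows "topspace (path_groupoid_topology E) = path_arrows E"
proof (intro equalityI subsetI)
  fix g assume "g \<in> topspace (path_groupoid_topology E)"
  then obtain \<alpha> \<beta> u u' x where
    "pre_digraph.awalk E u \<alpha> (tail E (x 0))" "pre_digraph.awalk E u' \<beta> (tail E (x 0))"
    "x \<in> inf_paths E" and
    g: "g = (conc \<alpha> x, int (length \<alpha>) - int (length \<beta>), conc \<beta> x)"
    by (auto simp: path_groupoid_topology_def topology_generated_by_topspace cylinder_def)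
  moreover have "shift_equiv (int (length \<alpha>) - int (length \<beta>)) (conc \<alpha> x) (conc \<beta> x)"
    unfolding shift_equiv_def
  proof (intro exI[of _ "length \<alpha>"] allI impI conjI)
    fix i assume "length \<alpha> \<le> i"
    then obtain j where i: "i = length \<alpha> + j" using le_Suc_ex by blast
    have "nat (int i - (int (length \<alpha>) - int (length \<beta>))) = length \<beta> + j"
      unfolding i by linarith
    then show "conc \<alpha> x i = conc \<beta> x (nat (int i - (int (length \<alpha>) - int (length \<beta>))))"
      by (simp add: conc_def i)
  qed simp
  ultimately show "g \<in> path_arrows E"
    using conc_inf_path[OF assms] by (auto simp: path_arrows_def)
next
  fix g assume "g \<in> path_arrows E"
  then obtain x k y N where g: "g = (x, k, y)" and x: "x \<in> inf_paths E" and y: "y \<in> inf_paths E"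
    and N: "\<And>i. i \<ge> N \<Longrightarrow> int i \<ge> k \<and> x i = y (nat (int i - k))"
    by (auto simp: path_arrows_def shift_equiv_def)
  define M where "M = nat (int N - k)"
  define z where "z = (\<lambda>i. x (N + i))"
  have M: "int M = int N - k" using N[of N] by (simp add: M_def)
  have z': "z i = y (M + i)" for i
  proof -
    have "nat (int (N + i) - k) = M + i" using M by linarith
    then show ?thesis using N[of "N + i"] by (simp add: z_def)
  qed
  have z: "z \<in> inf_paths E" using x by (auto simp: inf_paths_def z_def)
  have "pre_digraph.awalk E (tail E (x 0)) (map x [0..<N]) (tail E (z 0))"
    using awalk_prefix_inf_path[OF assms x, of N] by (simp add: z_def)
  moreover have "pre_digraph.awalk E (tail E (y 0)) (map y [0..<M]) (tail E (z 0))"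
    using awalk_prefix_inf_path[OF assms y, of M] by (simp add: z')
  moreover have "conc (map x [0..<N]) z = x"
    by (auto simp: conc_def fun_eq_iff z_def)
  moreover have "conc (map y [0..<M]) z = y"
    by (auto simp: conc_def fun_eq_iff z')
  moreover have "k = int N - int M" using M by simp
  ultimately have "g \<in> cylinder E (map x [0..<N]) (map y [0..<M]) (tail E (z 0))"
    unfolding g cylinder_def using z by (auto intro!: exI[of _ z])
  with \<open>pre_digraph.awalk E (tail E (x 0)) (map x [0..<N]) (tail E (z 0))\<close>
    \<open>pre_digraph.awalk E (tail E (y 0)) (map y [0..<M]) (tail E (z 0))\<close>
  show "g \<in> topspace (path_groupoid_topology E)"
    unfolding path_groupoid_topology_def topology_generated_by_topspace by blast
qed

end

theory Submission
  imports Defs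
begin

text \<open>In \<open>F\<close> both copies of \<open>v\<close> emit a copy of every edge leaving \<open>v\<close>, and the edges
  entering \<open>v\<close> are distributed over the two copies.  Hence an infinite path of \<open>E\<close> starting
  at \<open>v\<close> has exactly one lift to \<open>F\<close> starting at \<open>v''\<close>: the source of each lifted edge is
  forced by the preceding edge.  A lifted edge depends only on the edge and its
  predecessor, so lifting respects tail equivalence with the same lag and is continuous in
  both directions.\<close>

section \<open>Tail equivalence and the topology of pointed groupoids\<close>

text \<open>Counting each tail from its own start avoids truncated subtraction, and moving
  \<open>N\<close> and \<open>M\<close> by the same amount keeps the lag.\<close>

lemma shift_equiv_iff:
  "shift_equiv k x y \<longleftrightarrow> (\<exists>N M. int N - int M = k \<and> (\<forall>i. x (N + i) = y (M + i)))"
proof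
  assume "shift_equiv k x y"
  then obtain N where N: "\<And>i. i \<ge> N \<Longrightarrow> int i \<ge> k \<and> x i = y (nat (int i - k))"
    by (auto simp: shift_equiv_def)
  \<comment> \<open>The bound \<open>k \<le> int i\<close> at \<open>i = N\<close> makes
    \<open>int N - k\<close> nonnegative, so \<open>nat\<close> truncates nothing.\<close>
  define M where "M = nat (int N - k)"
  have M: "int M = int N - k"
    using N[of N] by (simp add: M_def)
  have "x (N + i) = y (M + i)" for i
  proof -
    have "nat (int (N + i) - k) = M + i"
      using M by linarith
    then show ?thesis
      using N[of "N + i"] by simp
  qed
  then show "\<exists>N M. int N - int M = k \<and> (\<forall>i. x (N + i) = y (M + i))"
    using M by (intro exI[of _ N] exI[of _ M]) simp
next
  assume "\<exists>N M. int N - int M = k \<and> (\<forall>i. x (N + i) = y (M + i))"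
  then obtain N M where k: "int N - int M = k" and tails: "\<And>i. x (N + i) = y (M + i)"
    by blast
  show "shift_equiv k x y"
    unfolding shift_equiv_def
  proof (intro exI[of _ N] allI impI conjI)
    fix i assume "N \<le> i"
    then obtain j where j: "i = N + j"
      using le_Suc_ex by blast
    have "nat (int i - k) = M + j"
      using k j by linarith
    then show "x i = y (nat (int i - k))"
      using tails j by simp
    show "k \<le> int i"
      using k \<open>N \<le> i\<close> by linarith
  qed
qed

text \<open>A graph-free form of the cylinder cut out by the first \<open>N\<close> letters of
  \<open>x\<close> and the first \<open>M\<close> of \<open>y\<close>. The graph enters only by
  intersecting with a set of arrows, so such sets can be compared across a map of words.\<close>

definition arrow_nhd :: "nat \<Rightarrow> nat \<Rightarrow> 'b word \<Rightarrow> 'b word \<Rightarrow> 'b path_arrow set" where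
  "arrow_nhd N M x y =
     {(x', int N - int M, y') | x' y'.
        (\<forall>i<N. x' i = x i) \<and> (\<forall>i<M. y' i = y i) \<and> (\<forall>i. x' (N + i) = y' (M + i))}"

text \<open>The next \<open>d\<close> letters of both tails are copied from \<open>x\<close> and
  \<open>y\<close>, which agree there; beyond them the tails agree anyway. So the neighbourhoods of
  one arrow shrink as both cuts move out together.\<close>

lemma arrow_nhd_antimono:
  assumes "\<And>i. x (N + i) = y (M + i)"
  shows "arrow_nhd (N + d) (M + d) x y \<subseteq> arrow_nhd N M x y"
proof -
  have "x' (N + i) = y' (M + i)"
    if x': "\<forall>i<N + d. x' i = x i" and y': "\<forall>i<M + d. y' i = y i"
      and tails: "\<forall>i. x' (N + d + i) = y' (M + d + i)" for x' y' :: "'a word" and i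
  proof (cases "i < d")
    case True
    then show ?thesis
      using x' y' assms by simp
  next
    case False
    then obtain j where "i = d + j"
      using le_Suc_ex[of d i] by auto
    then show ?thesis
      using tails by (simp add: add.assoc)
  qed
  then show ?thesis
    by (force simp: arrow_nhd_def)
qed

text \<open>The extra letter on each side fixes the first edge of the common tail, hence its source
  \<open>w\<close>. Prefixes of the exact lengths would leave that source free when both lists are
  empty.\<close>

lemma arrow_nhd_subset_cylinder:
  assumes x: "x = conc \<alpha> z" and y: "y = conc \<beta> z" and "tail E (z 0) = w"
    and g: "g \<in> path_arrows E" "g \<in> arrow_nhd (Suc (length \<alpha>)) (Suc (length \<beta>)) x y"
  shows "g \<in> cylinder E \<alpha> \<beta> w"
proof -
  from g(2) obtain x' y' where g': "g = (x', int (length \<alpha>) - int (length \<beta>), y')"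
    and x': "\<And>i. i < Suc (length \<alpha>) \<Longrightarrow> x' i = x i"
    and y': "\<And>i. i < Suc (length \<beta>) \<Longrightarrow> y' i = y i"
    and tails: "\<And>i. x' (Suc (length \<alpha>) + i) = y' (Suc (length \<beta>) + i)"
    by (auto simp: arrow_nhd_def)
  define z' where "z' = (\<lambda>i. x' (length \<alpha> + i))"
  have z0: "z' 0 = z 0"
    using x'[of "length \<alpha>"] x by (simp add: z'_def conc_def)
  \<comment> \<open>At index 0 agreement comes from the extra letters, as \<open>tails\<close>
    starts one place later.\<close>
  have z'y: "z' i = y' (length \<beta> + i)" for i
  proof (cases i)
    case 0
    then show ?thesis
      using z0 y'[of "length \<beta>"] y by (simp add: conc_def)
  next
    case (Suc j)
    then show ?thesis
      using tails[of j] by (simp add: z'_def)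
  qed
  have "z' \<in> inf_paths E"
    using g(1) g' by (auto simp: path_arrows_def inf_paths_def z'_def)
  moreover have "x' = conc \<alpha> z'"
    using x' x by (auto simp: fun_eq_iff conc_def z'_def)
  moreover have "y' = conc \<beta> z'"
    using y' y by (auto simp: fun_eq_iff conc_def z'y)
  ultimately show ?thesis
    unfolding cylinder_def g' using z0 assms(3) by auto
qed

lemma cylinder_prefixes_subset_arrow_nhd:
  "cylinder E (map x [0..<N]) (map y [0..<M]) w \<subseteq> arrow_nhd N M x y"
  by (auto simp: cylinder_def arrow_nhd_def conc_def)

text \<open>An openness test in terms of letters. The neighbourhood condition holds for cylinders
  and survives finite intersections and unions; conversely, the prefixes of an arrow up to a common
  tail give an open cylinder inside \<open>arrow_nhd\<close>.\<close>

lemma openin_pointed_groupoid_iff: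
  assumes "wf_digraph E"
  shows "openin (gtop (pointed_groupoid E S)) U \<longleftrightarrow>
    U \<subseteq> pointed_path_arrows E S \<and>
    (\<forall>x k y. (x, k, y) \<in> U \<longrightarrow>
      (\<exists>N M. int N - int M = k \<and> (\<forall>i. x (N + i) = y (M + i)) \<and>
        arrow_nhd N M x y \<inter> pointed_path_arrows E S \<subseteq> U))"
    (is "_ \<longleftrightarrow> U \<subseteq> ?P \<and> ?nhds U")
proof
  let ?C = "{cylinder E \<alpha> \<beta> w | \<alpha> \<beta> u u' w.
    pre_digraph.awalk E u \<alpha> w \<and> pre_digraph.awalk E u' \<beta> w}"
  have P: "?P \<subseteq> path_arrows E"
    by (auto simp: pointed_path_arrows_def)
  have nhds: "?nhds (V \<inter> ?P)" if "generate_topology_on ?C V" for V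
    using that
  proof induction
    case Empty
    then show ?case by simp
  next
    case (Int V W)
    show ?case
    proof (intro allI impI)
      fix x k y assume g: "(x, k, y) \<in> V \<inter> W \<inter> ?P"
      with Int.IH(1) obtain N M where 1: "int N - int M = k" "\<And>i. x (N + i) = y (M + i)"
        "arrow_nhd N M x y \<inter> ?P \<subseteq> V \<inter> ?P"
        by blast
      from g Int.IH(2) obtain N' M' where 2: "int N' - int M' = k"
        "\<And>i. x (N' + i) = y (M' + i)" "arrow_nhd N' M' x y \<inter> ?P \<subseteq> W \<inter> ?P"
        by blast
      \<comment> \<open>Both pairs have lag \<open>k\<close>, so \<open>N + N'\<close> with
        \<open>M + N'\<close> is a joint shift of either pair.\<close>
      have eq: "N + N' = N' + N" "M + N' = M' + N"
        using 1(1) 2(1) by linarith+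
      have "arrow_nhd (N + N') (M + N') x y \<subseteq> arrow_nhd N M x y"
        using 1(2) by (rule arrow_nhd_antimono)
      moreover have "arrow_nhd (N + N') (M + N') x y \<subseteq> arrow_nhd N' M' x y"
        unfolding eq using 2(2) by (rule arrow_nhd_antimono)
      moreover have "x (N + N' + i) = y (M + N' + i)" for i
        using 1(2)[of "N' + i"] by (simp add: add.assoc)
      ultimately show "\<exists>N M. int N - int M = k \<and> (\<forall>i. x (N + i) = y (M + i)) \<and>
          arrow_nhd N M x y \<inter> ?P \<subseteq> V \<inter> W \<inter> ?P"
        using 1 2 by (intro exI[of _ "N + N'"] exI[of _ "M + N'"]) auto
    qed
  next
    case (UN K)
    show ?case
    proof (intro allI impI)
      fix x k y assume "(x, k, y) \<in> \<Union> K \<inter> ?P"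
      then obtain V where V: "V \<in> K" "(x, k, y) \<in> V \<inter> ?P"
        by blast
      from UN.IH[OF V(1)] V(2) obtain N M where
        "int N - int M = k" "\<forall>i. x (N + i) = y (M + i)" "arrow_nhd N M x y \<inter> ?P \<subseteq> V \<inter> ?P"
        by blast
      then show "\<exists>N M. int N - int M = k \<and> (\<forall>i. x (N + i) = y (M + i)) \<and>
          arrow_nhd N M x y \<inter> ?P \<subseteq> \<Union> K \<inter> ?P"
        using V(1) by (intro exI[of _ N] exI[of _ M]) blast
    qed
  next
    case (Basis V)
    then obtain \<alpha> \<beta> w where V: "V = cylinder E \<alpha> \<beta> w"
      by blast
    show ?case
    proof (intro allI impI)
      fix x k y assume "(x, k, y) \<in> V \<inter> ?P"
      then obtain z where z: "x = conc \<alpha> z" "y = conc \<beta> z" "tail E (z 0) = w"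
        and k: "k = int (length \<alpha>) - int (length \<beta>)"
        by (auto simp: V cylinder_def)
      show "\<exists>N M. int N - int M = k \<and> (\<forall>i. x (N + i) = y (M + i)) \<and>
          arrow_nhd N M x y \<inter> ?P \<subseteq> V \<inter> ?P"
        using k z arrow_nhd_subset_cylinder[where E = E, OF z] P
        by (intro exI[of _ "Suc (length \<alpha>)"] exI[of _ "Suc (length \<beta>)"])
          (auto simp: V conc_def)
    qed
  qed
  {
    assume "openin (gtop (pointed_groupoid E S)) U"
    then obtain V where "generate_topology_on ?C V" "U = V \<inter> ?P"
      by (auto simp: pointed_groupoid_def openin_subtopology path_groupoid_topology_def
          openin_topology_generated_by_iff)
    then show "U \<subseteq> ?P \<and> ?nhds U"
      using nhds by blast
  }
  {
    assume U: "U \<subseteq> ?P \<and> ?nhds U"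
    show "openin (gtop (pointed_groupoid E S)) U"
    proof (subst openin_subopen, intro ballI)
      fix g assume "g \<in> U"
      obtain x k y where g: "g = (x, k, y)"
        by (cases g)
      with U \<open>g \<in> U\<close> obtain N M where k: "int N - int M = k"
        and tails: "\<And>i. x (N + i) = y (M + i)" and sub: "arrow_nhd N M x y \<inter> ?P \<subseteq> U"
        by blast
      have "g \<in> path_arrows E"
        using U P \<open>g \<in> U\<close> by blast
      then have xy: "x \<in> inf_paths E" "y \<in> inf_paths E"
        by (auto simp: g path_arrows_def)
      \<comment> \<open>Both prefixes end at the same vertex, since the tails agree from
        \<open>N\<close> and \<open>M\<close> on; this makes \<open>?Z\<close> a generating
        cylinder.\<close>
      let ?Z = "cylinder E (map x [0..<N]) (map y [0..<M]) (tail E (x N))"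
      have "tail E (x N) = tail E (y M)"
        using tails[of 0] by simp
      then have "?Z \<in> ?C"
        using awalk_prefix_inf_path[OF assms xy(1), of N]
          awalk_prefix_inf_path[OF assms xy(2), of M] by force
      then have "openin (path_groupoid_topology E) ?Z"
        unfolding path_groupoid_topology_def by (rule topology_generated_by_Basis)
      then have "openin (gtop (pointed_groupoid E S)) (?Z \<inter> ?P)"
        by (auto simp: pointed_groupoid_def openin_subtopology)
      moreover have "g \<in> ?Z \<inter> ?P"
      proof -
        have "(\<lambda>i. x (N + i)) \<in> inf_paths E"
          using xy(1) by (auto simp: inf_paths_def)
        moreover have "conc (map x [0..<N]) (\<lambda>i. x (N + i)) = x"
          by (auto simp: conc_def fun_eq_iff)
        moreover have "conc (map y [0..<M]) (\<lambda>i. x (N + i)) = y"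
          by (auto simp: conc_def fun_eq_iff tails)
        ultimately have "g \<in> ?Z"
          unfolding g cylinder_def using k by (auto intro!: exI[of _ "\<lambda>i. x (N + i)"])
        then show ?thesis
          using U \<open>g \<in> U\<close> by blast
      qed
      moreover have "?Z \<inter> ?P \<subseteq> U"
        using cylinder_prefixes_subset_arrow_nhd[of E x N y M "tail E (x N)"] sub by blast
      ultimately show "\<exists>V. openin (gtop (pointed_groupoid E S)) V \<and> g \<in> V \<and> V \<subseteq> U"
        by blast
    qed
  }
qed

lemma topspace_pointed_groupoid:
  assumes "wf_digraph E"
  shows "topspace (gtop (pointed_groupoid E S)) = pointed_path_arrows E S"
  using topspace_path_groupoid_topology[OF assms]
  by (auto simp: pointed_groupoid_def pointed_path_arrows_def)

section \<open>Isomorphisms induced by maps of infinite paths\<close>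

definition pointed_paths :: "('a, 'b) pre_digraph \<Rightarrow> 'a set \<Rightarrow> 'b word set" where
  "pointed_paths E S = {x \<in> inf_paths E. tail E (x 0) \<in> S}"

lemma pointed_path_arrows_iff:
  "(x, k, y) \<in> pointed_path_arrows E S \<longleftrightarrow>
     x \<in> pointed_paths E S \<and> y \<in> pointed_paths E S \<and>
     (\<exists>N M. int N - int M = k \<and> (\<forall>i. x (N + i) = y (M + i)))"
  by (auto simp: pointed_path_arrows_def path_arrows_def pointed_paths_def shift_equiv_iff)

text \<open>\<open>start\<close> and \<open>step\<close> say that \<open>l\<close> is a sliding
  block code reading a letter and its predecessor; \<open>letter\<close> says that it is decoded one
  letter at a time, independently of position. Agreement of tails passes through \<open>l\<close>
  one place late and comes back without delay, which preserves the lag and makes the map on arrows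
  continuous and open.\<close>

lemma isomorphic_pointed_groupoidsI:
  fixes l :: "'b word \<Rightarrow> 'd word"
  assumes wf: "wf_digraph E" "wf_digraph F"
    and bij: "bij_betw l (pointed_paths E S) (pointed_paths F T)"
    and letter: "\<And>x y n m. x \<in> pointed_paths E S \<Longrightarrow> y \<in> pointed_paths E S \<Longrightarrow>
      l x n = l y m \<Longrightarrow> x n = y m"
    and start: "\<And>x y. x 0 = y 0 \<Longrightarrow> l x 0 = l y 0"
    and step: "\<And>x y n m. x n = y m \<Longrightarrow> x (Suc n) = y (Suc m) \<Longrightarrow> l x (Suc n) = l y (Suc m)"
  shows "isomorphic_top_groupoids (pointed_groupoid E S) (pointed_groupoid F T)"
proof -
  let ?A = "pointed_paths E S" and ?B = "pointed_paths F T"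
  let ?P = "pointed_path_arrows E S" and ?Q = "pointed_path_arrows F T"
  let ?G = "pointed_groupoid E S" and ?H = "pointed_groupoid F T"
  define \<phi> where "\<phi> = (\<lambda>(x, k :: int, y). (l x, k, l y))"
  have inj: "inj_on l ?A" and im: "l ` ?A = ?B"
    using bij by (auto simp: bij_betw_def)
  have l_eq: "l x = l y \<longleftrightarrow> x = y" if "x \<in> ?A" "y \<in> ?A" for x y
    using inj that by (auto dest: inj_onD)
  have prefix: "l x i = l y i" if "\<forall>i<n. x i = y i" "i < n" for x y n i
    using that by (cases i) (auto intro: start step)
  \<comment> \<open>The lifted letter at \<open>N\<close> may read the letter before it, where
    nothing is known to agree.\<close>
  have tails: "l x (Suc N + i) = l y (Suc M + i)" if "\<forall>i. x (N + i) = y (M + i)" for x y N M i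
    using step[of x "N + i" y "M + i"] that[rule_format, of i] that[rule_format, of "Suc i"]
    by simp
  have arrow: "(l x, k, l y) \<in> ?Q \<longleftrightarrow> (x, k, y) \<in> ?P" if "x \<in> ?A" "y \<in> ?A" for x k y
  proof
    assume "(l x, k, l y) \<in> ?Q"
    then obtain N M where "int N - int M = k" "\<forall>i. l x (N + i) = l y (M + i)"
      by (auto simp: pointed_path_arrows_iff)
    then have "int N - int M = k" "\<forall>i. x (N + i) = y (M + i)"
      using letter[OF that] by blast+
    then show "(x, k, y) \<in> ?P"
      unfolding pointed_path_arrows_iff using that by blast
  next
    assume "(x, k, y) \<in> ?P"
    then obtain N M where "int N - int M = k" "\<forall>i. x (N + i) = y (M + i)"
      by (auto simp: pointed_path_arrows_iff)
    then have "int (Suc N) - int (Suc M) = k" "\<forall>i. l x (Suc N + i) = l y (Suc M + i)"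
      using tails by auto
    then show "(l x, k, l y) \<in> ?Q"
      unfolding pointed_path_arrows_iff using that im by blast
  qed
  have inj_\<phi>: "inj_on \<phi> ?P"
    using l_eq by (auto simp: inj_on_def \<phi>_def pointed_path_arrows_iff)
  have im_\<phi>: "\<phi> ` ?P = ?Q"
  proof (intro equalityI subsetI)
    fix g assume "g \<in> \<phi> ` ?P"
    then show "g \<in> ?Q"
      using arrow by (auto simp: \<phi>_def pointed_path_arrows_iff)
  next
    fix g assume g: "g \<in> ?Q"
    obtain x' k y' where g': "g = (x', k, y')"
      by (cases g)
    with g have "x' \<in> l ` ?A" "y' \<in> l ` ?A"
      using im by (auto simp: pointed_path_arrows_iff)
    then obtain x y where "x \<in> ?A" "y \<in> ?A" "x' = l x" "y' = l y"
      by blast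
    then show "g \<in> \<phi> ` ?P"
      using g g' arrow by (auto simp: \<phi>_def image_iff intro!: bexI[of _ "(x, k, y)"])
  qed
  have "open_map (gtop ?G) (gtop ?H) \<phi>"
    unfolding open_map_def
  proof (intro allI impI)
    fix U assume "openin (gtop ?G) U"
    then have UP: "U \<subseteq> ?P" and nhds: "\<And>x k y. (x, k, y) \<in> U \<Longrightarrow>
      \<exists>N M. int N - int M = k \<and> (\<forall>i. x (N + i) = y (M + i)) \<and> arrow_nhd N M x y \<inter> ?P \<subseteq> U"
      unfolding openin_pointed_groupoid_iff[OF wf(1)] by blast+
    show "openin (gtop ?H) (\<phi> ` U)"
      unfolding openin_pointed_groupoid_iff[OF wf(2)]
    proof (intro conjI allI impI)
      show "\<phi> ` U \<subseteq> ?Q"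
        using UP im_\<phi> by blast
      fix a k b assume "(a, k, b) \<in> \<phi> ` U"
      then obtain x y where g: "(x, k, y) \<in> U" and ab: "a = l x" "b = l y"
        by (auto simp: \<phi>_def)
      then have xy: "x \<in> ?A" "y \<in> ?A"
        using UP by (auto simp: pointed_path_arrows_iff)
      obtain N M where NM: "int N - int M = k" "\<forall>i. x (N + i) = y (M + i)"
        and sub: "arrow_nhd N M x y \<inter> ?P \<subseteq> U"
        using nhds[OF g] by blast
      \<comment> \<open>The cut moves to \<open>Suc N\<close> and \<open>Suc M\<close> because the
        tails of \<open>a\<close> and \<open>b\<close> are only known to agree from there.\<close>
      have "arrow_nhd (Suc N) (Suc M) a b \<inter> ?Q \<subseteq> \<phi> ` U"
      proof
        fix h assume h: "h \<in> arrow_nhd (Suc N) (Suc M) a b \<inter> ?Q"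
        then obtain x' k' y' where h': "h = \<phi> (x', k', y')" and g': "(x', k', y') \<in> ?P"
          unfolding im_\<phi>[symmetric] by auto
        then have xy': "x' \<in> ?A" "y' \<in> ?A"
          by (auto simp: pointed_path_arrows_iff)
        have "(x', k', y') \<in> arrow_nhd (Suc N) (Suc M) x y"
          using h xy xy' unfolding h' ab
          by (auto simp: arrow_nhd_def \<phi>_def intro: letter)
        then have "(x', k', y') \<in> arrow_nhd N M x y"
          using arrow_nhd_antimono[of x N y M 1] NM(2) by auto
        then show "h \<in> \<phi> ` U"
          using g' sub h' by blast
      qed
      then show "\<exists>N M. int N - int M = k \<and> (\<forall>i. a (N + i) = b (M + i)) \<and>
          arrow_nhd N M a b \<inter> ?Q \<subseteq> \<phi> ` U"
        using NM(1) tails[OF NM(2)] ab by (intro exI[of _ "Suc N"] exI[of _ "Suc M"]) simp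
    qed
  qed
  moreover have "continuous_map (gtop ?G) (gtop ?H) \<phi>"
    unfolding continuous_map_def
  proof (intro conjI allI impI)
    show "\<phi> \<in> topspace (gtop ?G) \<rightarrow> topspace (gtop ?H)"
      using im_\<phi> by (auto simp: topspace_pointed_groupoid wf)
    fix V assume "openin (gtop ?H) V"
    then have nhds: "\<And>x k y. (x, k, y) \<in> V \<Longrightarrow>
      \<exists>N M. int N - int M = k \<and> (\<forall>i. x (N + i) = y (M + i)) \<and> arrow_nhd N M x y \<inter> ?Q \<subseteq> V"
      unfolding openin_pointed_groupoid_iff[OF wf(2)] by blast
    let ?U = "{g \<in> topspace (gtop ?G). \<phi> g \<in> V}"
    show "openin (gtop ?G) ?U"
      unfolding openin_pointed_groupoid_iff[OF wf(1)] topspace_pointed_groupoid[OF wf(1)]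
    proof (intro conjI allI impI)
      fix x k y assume "(x, k, y) \<in> {g \<in> ?P. \<phi> g \<in> V}"
      then have g: "(l x, k, l y) \<in> V" and xy: "x \<in> ?A" "y \<in> ?A"
        by (auto simp: \<phi>_def pointed_path_arrows_iff)
      obtain N M where NM: "int N - int M = k" and eq: "\<And>i. l x (N + i) = l y (M + i)"
        and sub: "arrow_nhd N M (l x) (l y) \<inter> ?Q \<subseteq> V"
        using nhds[OF g] by blast
      have xy_tails: "\<forall>i. x (N + i) = y (M + i)"
        using letter[OF xy eq] by blast
      \<comment> \<open>Tails agreeing from \<open>N\<close> and \<open>M\<close> on have lifts
        agreeing one place later; the lifted letters at \<open>N\<close> and \<open>M\<close> that
        this leaves out are fixed by the longer prefixes.\<close>
      have "arrow_nhd (Suc N) (Suc M) x y \<inter> ?P \<subseteq> {g \<in> ?P. \<phi> g \<in> V}"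
      proof
        fix h assume h: "h \<in> arrow_nhd (Suc N) (Suc M) x y \<inter> ?P"
        then have "h \<in> arrow_nhd N M x y"
          using arrow_nhd_antimono[of x N y M 1] xy_tails by auto
        then obtain x' y' where h': "h = (x', int N - int M, y')"
          and tails': "\<forall>i. x' (N + i) = y' (M + i)"
          by (auto simp: arrow_nhd_def)
        have pre: "\<forall>i<Suc N. x' i = x i" "\<forall>i<Suc M. y' i = y i"
          using h by (auto simp: arrow_nhd_def h')
        have "\<phi> h \<in> arrow_nhd (N + 1) (M + 1) (l x) (l y)"
          using prefix[OF pre(1)] prefix[OF pre(2)] tails[OF tails']
          by (simp add: arrow_nhd_def \<phi>_def h')
        then have "\<phi> h \<in> arrow_nhd N M (l x) (l y)"
          using arrow_nhd_antimono[of "l x" N "l y" M 1] eq by blast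
        moreover have "\<phi> h \<in> ?Q"
          using h im_\<phi> by blast
        ultimately show "h \<in> {g \<in> ?P. \<phi> g \<in> V}"
          using h sub by blast
      qed
      moreover have "\<forall>i. x (Suc N + i) = y (Suc M + i)"
        using xy_tails by (metis add_Suc_shift)
      ultimately show "\<exists>N M. int N - int M = k \<and> (\<forall>i. x (N + i) = y (M + i)) \<and>
          arrow_nhd N M x y \<inter> ?P \<subseteq> {g \<in> ?P. \<phi> g \<in> V}"
        using NM by (intro exI[of _ "Suc N"] exI[of _ "Suc M"]) simp
    qed blast
  qed
  ultimately have "homeomorphic_map (gtop ?G) (gtop ?H) \<phi>"
    using inj_\<phi> im_\<phi>
    by (intro bijective_open_imp_homeomorphic_map) (simp_all add: topspace_pointed_groupoid wf)
  moreover have "bij_betw \<phi> ?P ?Q"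
    using inj_\<phi> im_\<phi> by (simp add: bij_betw_def)
  moreover have "((g, h) \<in> gcomposable ?G \<longleftrightarrow> (\<phi> g, \<phi> h) \<in> gcomposable ?H) \<and>
      \<phi> (gmult ?G g h) = gmult ?H (\<phi> g) (\<phi> h)" if gh: "g \<in> ?P" "h \<in> ?P" for g h
  proof -
    obtain x k y y' m z where gh': "g = (x, k, y)" "h = (y', m, z)"
      by (cases g, cases h) auto
    have "\<phi> g \<in> ?Q" "\<phi> h \<in> ?Q"
      using gh im_\<phi> by blast+
    \<comment> \<open>Composability is equality of the two middle paths, so injectivity of
      \<open>l\<close> settles it in both directions.\<close>
    moreover have "l y = l y' \<longleftrightarrow> y = y'"
      using gh l_eq by (auto simp: gh' pointed_path_arrows_iff)
    ultimately show ?thesis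
      using gh by (auto simp: pointed_groupoid_def gh' \<phi>_def)
  qed
  moreover have "\<phi> (ginv ?G g) = ginv ?H (\<phi> g)" for g
    by (cases g) (simp add: pointed_groupoid_def \<phi>_def)
  moreover have "arrows ?G = ?P" "arrows ?H = ?Q"
    by (simp_all add: pointed_groupoid_def)
  ultimately show ?thesis
    unfolding isomorphic_top_groupoids_def top_groupoid_isomorphism_def
    by (intro exI[of _ \<phi>]) auto
qed

section \<open>Lifting paths to the reverse explosion\<close>

text \<open>The fibre over \<open>u\<close> of the map that glues the two copies of \<open>v\<close>
  back together.\<close>

definition vertex_copies :: "'a \<Rightarrow> 'a \<Rightarrow> 'a exploded set" where
  "vertex_copies v u = (if u = v then {Split1, Split2} else {Kept u})"

text \<open>The common range of all copies of \<open>a\<close>. Edges into \<open>v\<close>, which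
  is \<open>head E e\<close> here, are distributed over the two copies, with \<open>e\<close> alone
  at \<open>Split1\<close>.\<close>

definition lifted_head :: "('a, 'b) pre_digraph \<Rightarrow> 'b \<Rightarrow> 'b \<Rightarrow> 'a exploded" where
  "lifted_head E e a =
     (if head E a \<noteq> head E e then Kept (head E a) else if a = e then Split1 else Split2)"

text \<open>Letters are pairs of range and source. The source is the lifted range of the
  predecessor; position 0 has none and takes \<open>Split2\<close>, the base point in
  \<open>F\<close>.\<close>

definition lift_path ::
    "('a, 'b) pre_digraph \<Rightarrow> 'b \<Rightarrow> 'b word \<Rightarrow> ('a exploded \<times> 'a exploded) word" where
  "lift_path E e x n =
     (lifted_head E e (x n), case n of 0 \<Rightarrow> Split2 | Suc m \<Rightarrow> lifted_head E e (x m))"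

lemma lifted_head_in_copies: "lifted_head E e a \<in> vertex_copies (head E e) (head E a)"
  by (simp add: lifted_head_def vertex_copies_def)

lemma vertex_copies_disjoint:
  "t \<in> vertex_copies v u \<Longrightarrow> t \<in> vertex_copies v u' \<Longrightarrow> u = u'"
  by (auto simp: vertex_copies_def split: if_splits)

text \<open>Arcs of \<open>F\<close> are pairs in the orientation of the reversed graph, so the range comes
  first.\<close>

lemma reverse_explosion_structure:
  assumes "is_reverse_explosion E e F"
  shows "e \<in> arcs E"
    and "tail F = snd"
    and "head F = fst"
    and "verts F = Kept ` (verts E - {head E e}) \<union> {Split1, Split2}"
    and "arcs F = {(lifted_head E e a, t) | a t.
      a \<in> arcs E \<and> t \<in> vertex_copies (head E e) (tail E a)}"
proof -
  from assms have e: "e \<in> arcs E"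
    and F: "reverse_graph F = edge_explosion (reverse_graph E) e"
    by (auto simp: is_reverse_explosion_def is_edge_explosion_def reverse_graph_def)
  show "e \<in> arcs E"
    by (fact e)
  show "tail F = snd" "head F = fst"
    "verts F = Kept ` (verts E - {head E e}) \<union> {Split1, Split2}"
    using F by (auto simp: reverse_graph_def edge_explosion_def Let_def)
  have "arcs F = arcs (edge_explosion (reverse_graph E) e)"
    using F by (metis reverse_graph_def pre_digraph.select_convs(2))
  \<comment> \<open>The seven families collapse into one: a reversed edge leaves its lifted head, as
    selected by \<open>M1\<close> or \<open>M2\<close> at \<open>v\<close>, and enters every copy of
    its other end. Loops at \<open>v\<close> follow the same rule.\<close>
  also have "\<dots> = {(lifted_head E e a, t) | a t.
      a \<in> arcs E \<and> t \<in> vertex_copies (head E e) (tail E a)}" (is "?L = ?R")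
  proof (intro equalityI subsetI)
    fix p assume "p \<in> ?L"
    then show "p \<in> ?R"
      using e
      by (force simp: reverse_graph_def edge_explosion_def Let_def out_arcs_def
          lifted_head_def vertex_copies_def split: if_splits)
  next
    fix p assume "p \<in> ?R"
    then show "p \<in> ?L"
      using e
      by (auto simp: reverse_graph_def edge_explosion_def Let_def out_arcs_def
          lifted_head_def vertex_copies_def split: if_splits)
  qed
  finally show "arcs F = {(lifted_head E e a, t) | a t.
      a \<in> arcs E \<and> t \<in> vertex_copies (head E e) (tail E a)}" .
qed

lemma wf_digraph_reverse_explosion:
  assumes "wf_digraph E" and "is_reverse_explosion E e F"
  shows "wf_digraph F"
proof -
  interpret wf_digraph E by (fact assms(1))
  show ?thesis
    by unfold_locales
      (auto simp: reverse_explosion_structure[OF assms(2)] lifted_head_def vertex_copies_def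
        split: if_splits)
qed

text \<open>A lifted letter reveals both ends of the original edge, as distinct vertices have
  disjoint fibres, and without multiple edges the ends determine the edge. For surjectivity, choose
  an edge under each letter of a path in \<open>F\<close>; the same disjointness makes the chosen
  edges consecutive.\<close>

lemma bij_betw_lift_path:
  assumes nomulti: "nomulti_digraph E" and F: "is_reverse_explosion E e F"
  shows "bij_betw (lift_path E e) (pointed_paths E {head E e}) (pointed_paths F {Split2})"
    and "\<And>x y n m. x \<in> pointed_paths E {head E e} \<Longrightarrow> y \<in> pointed_paths E {head E e} \<Longrightarrow>
      lift_path E e x n = lift_path E e y m \<Longrightarrow> x n = y m"
proof -
  interpret nomulti_digraph E by (fact nomulti)
  note F_eqs = reverse_explosion_structure[OF F]
  let ?v = "head E e" and ?h = "lifted_head E e" and ?l = "lift_path E e"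
  \<comment> \<open>At position 0 the default \<open>Split2\<close> lies over the source because the
    path starts at \<open>head E e\<close>.\<close>
  have copies: "snd (?l x n) \<in> vertex_copies ?v (tail E (x n))"
    if "x \<in> pointed_paths E {?v}" for x n
  proof (cases n)
    case 0
    then show ?thesis
      using that by (simp add: lift_path_def pointed_paths_def vertex_copies_def)
  next
    case (Suc m)
    then have "head E (x m) = tail E (x n)"
      using that by (simp add: pointed_paths_def inf_paths_def)
    then show ?thesis
      using lifted_head_in_copies[of E e "x m"] Suc by (simp add: lift_path_def)
  qed
  show letter: "x n = y m"
    if xy: "x \<in> pointed_paths E {?v}" "y \<in> pointed_paths E {?v}" and eq: "?l x n = ?l y m"
    for x y n m
  proof -
    have "tail E (x n) = tail E (y m)"
      using copies[OF xy(1), of n] copies[OF xy(2), of m] eq by (metis vertex_copies_disjoint)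
    moreover have "?h (x n) = ?h (y m)"
      using eq by (simp add: lift_path_def)
    then have "head E (x n) = head E (y m)"
      by (metis lifted_head_in_copies vertex_copies_disjoint)
    ultimately show ?thesis
      using xy no_multi_arcs[of "x n" "y m"]
      by (auto simp: pointed_paths_def inf_paths_def arc_to_ends_def)
  qed
  show "bij_betw ?l (pointed_paths E {?v}) (pointed_paths F {Split2})"
    unfolding bij_betw_def
  proof (intro conjI equalityI subsetI)
    show "inj_on ?l (pointed_paths E {?v})"
      by (intro inj_onI ext letter) auto
  next
    fix X assume "X \<in> ?l ` pointed_paths E {?v}"
    then obtain x where x: "x \<in> pointed_paths E {?v}" and X: "X = ?l x"
      by blast
    have "X i \<in> arcs F" for i
    proof -
      have "X i = (?h (x i), snd (X i))"
        by (simp add: X lift_path_def)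
      moreover have "x i \<in> arcs E"
        using x by (simp add: pointed_paths_def inf_paths_def)
      ultimately show ?thesis
        unfolding F_eqs using copies[OF x, of i] X by blast
    qed
    then show "X \<in> pointed_paths F {Split2}"
      by (simp add: pointed_paths_def inf_paths_def F_eqs(2,3)) (simp add: X lift_path_def)
  next
    fix X assume X: "X \<in> pointed_paths F {Split2}"
    then have "X n \<in> arcs F" for n
      by (simp add: pointed_paths_def inf_paths_def)
    then have "\<exists>a t. X n = (?h a, t) \<and> a \<in> arcs E \<and> t \<in> vertex_copies ?v (tail E a)" for n
      unfolding F_eqs(5) by blast
    then have "\<forall>n. \<exists>a. a \<in> arcs E \<and> fst (X n) = ?h a \<and>
        snd (X n) \<in> vertex_copies ?v (tail E a)"
      by (metis fst_conv snd_conv)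
    then obtain x where x: "\<And>n. x n \<in> arcs E" and fst: "\<And>n. fst (X n) = ?h (x n)"
      and snd: "\<And>n. snd (X n) \<in> vertex_copies ?v (tail E (x n))"
      by metis
    have X_link: "fst (X n) = snd (X (Suc n))" and X_start: "snd (X 0) = Split2" for n
      using X by (simp_all add: pointed_paths_def inf_paths_def F_eqs(2,3))
    have "head E (x n) = tail E (x (Suc n))" for n
      using lifted_head_in_copies[of E e "x n"] snd[of "Suc n"]
      by (simp add: fst X_link[symmetric] vertex_copies_disjoint)
    moreover have "tail E (x 0) = ?v"
      using snd[of 0] X_start by (auto simp: vertex_copies_def split: if_splits)
    ultimately have "x \<in> pointed_paths E {?v}"
      using x by (simp add: pointed_paths_def inf_paths_def)
    \<comment> \<open>Ranges match by the choice of \<open>x\<close>; sources are forced by the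
      predecessor, or by \<open>X_start\<close> at position 0.\<close>
    moreover have "X n = ?l x n" for n
      using X_start X_link fst
      by (cases n) (auto simp: lift_path_def prod_eq_iff simp flip: X_link)
    then have "X = ?l x"
      by blast
    ultimately show "X \<in> ?l ` pointed_paths E {?v}"
      by blast
  qed
qed

theorem proposition6p9:
  fixes E :: "('a, 'b) pre_digraph"
    and F :: "('a exploded, 'a exploded \<times> 'a exploded) pre_digraph"
    and v :: 'a and e :: 'b
  assumes "countable_graph E"
    and "row_finite E"
    and "cofinal_vertex E v"
    and "tail (reverse_graph E) e = v"
    and "is_reverse_explosion E e F"
  shows "isomorphic_top_groupoids (pointed_groupoid E {v}) (pointed_groupoid F {Split2})"
proof -
  have nomulti: "nomulti_digraph E"
    using assms(1) by (simp add: countable_graph_def)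
  then have wf: "wf_digraph E"
    by (simp add: nomulti_digraph_def)
  have v: "v = head E e"
    using assms(4) by (simp add: reverse_graph_def)
  show ?thesis
    unfolding v
  proof (rule isomorphic_pointed_groupoidsI[where l = "lift_path E e"])
    show "wf_digraph F"
      using wf assms(5) by (rule wf_digraph_reverse_explosion)
  \<comment> \<open>\<open>start\<close> and \<open>step\<close> are immediate, since
    \<open>lift_path\<close> reads only the current letter and its predecessor.\<close>
  qed (use wf bij_betw_lift_path[OF nomulti assms(5)] in \<open>auto simp: lift_path_def\<close>)
qed

end
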